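(* Let $G$ be a finite cyclic group and let $\mathcal{A}$ be the intersection of a nonempty family of coset S-rings over $G$. If $\mathcal{A}$ contains (as a subring of $\mathbb{Z}G$) a quasidense S-ring over $G$, then $\mathcal{A}$ is a coset S-ring.
   Context: An S-ring over a finite group $G$ is a subring $\mathcal{A}$ of the group ring $\mathbb{Z}G$ for which there is a partition $\mathcal{S}(\mathcal{A})$ of $G$ (its classes are called basic sets) such that $\{1_G\}\in\mathcal{S}(\mathcal{A})$; $X\in\mathcal{S}(\mathcal{A})$ implies $X^{-1}\in\mathcal{S}(\mathcal{A})$; and $\mathcal{A}$ is the $\mathbb{Z}$-span of the elements $\sum_{x\in X}x$, $X\in\mathcal{S}(\mathcal{A})$. The intersection of S-rings over $G$ is an S-ring over $G$. An $\mathcal{A}$-group is a subgroup of $G$ that is a union of basic sets. A section $S=U/L$ of $G$ ($L$ normal in $U\le G$) is an $\mathcal{A}$-section if $U$ and $L$ are $\mathcal{A}$-groups; then $\mathcal{A}_S$ denotes the S-ring over $S$ whose basic sets are $\pi_S(X)$, $X\in\mathcal{S}(\mathcal{A})$, $X\subseteq U$, where $\pi_S:U\to S$ is the quotient epimorphism. An S-ring over a nontrivial group is primitive if its only $\mathcal{A}$-groups are the trivial one and the whole group; an $\mathcal{A}$-section $S$ is primitive if $\mathcal{A}_S$ is. An S-ring over a cyclic group is quasidense if every primitive section of it has prime order. A coset S-ring over an abelian group $G$ is an S-ring each basic set of which is a coset of a subgroup of $G$. *)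

theory Defs
  imports
    "HOL-Algebra.Elementary_Groups"
    "HOL-Algebra.Subrings"
    "HOL-Computational_Algebra.Primes"
    "HOL-Library.Disjoint_Sets"
begin

text \<open>
  The integral group ring of a finite group. An element is its coefficient function, extended
  by 0 outside the carrier. All definitions below are meant for finite groups only.
\<close>

definition group_ring :: "('a, 'b) monoid_scheme \<Rightarrow> ('a \<Rightarrow> int) ring" where
  "group_ring G =
     \<lparr>carrier = {f. \<forall>x. x \<notin> carrier G \<longrightarrow> f x = 0},
      monoid.mult = (\<lambda>f g z. \<Sum>(x, y) \<in> {(x, y). x \<in> carrier G \<and> y \<in> carrier G \<and> x \<otimes>\<^bsub>G\<^esub> y = z}. f x * g y),
      one = (\<lambda>x. if x = \<one>\<^bsub>G\<^esub> then 1 else 0),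
      ring.zero = (\<lambda>x. 0),
      ring.add = (\<lambda>f g x. f x + g x)\<rparr>"

text \<open>The element \<open>\<Sum>x\<in>X. x\<close> of the group ring.\<close>

definition simple_quantity :: "'a set \<Rightarrow> 'a \<Rightarrow> int" where
  "simple_quantity X = (\<lambda>x. if x \<in> X then 1 else 0)"

text \<open>The set of integral linear combinations of the \<open>simple_quantity X\<close> with \<open>X \<in> P\<close>, for finite \<open>P\<close>.\<close>

definition int_span :: "'a set set \<Rightarrow> ('a \<Rightarrow> int) set" where
  "int_span P = {f. \<exists>c. f = (\<lambda>x. \<Sum>X\<in>P. c X * simple_quantity X x)}"

definition is_basic_partition ::
    "('a, 'b) monoid_scheme \<Rightarrow> ('a \<Rightarrow> int) set \<Rightarrow> 'a set set \<Rightarrow> bool" where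
  "is_basic_partition G \<A> P \<longleftrightarrow>
     partition_on (carrier G) P \<and>
     {\<one>\<^bsub>G\<^esub>} \<in> P \<and>
     (\<forall>X\<in>P. set_inv\<^bsub>G\<^esub> X \<in> P) \<and>
     \<A> = int_span P"

definition S_ring :: "('a, 'b) monoid_scheme \<Rightarrow> ('a \<Rightarrow> int) set \<Rightarrow> bool" where
  "S_ring G \<A> \<longleftrightarrow> subring \<A> (group_ring G) \<and> (\<exists>P. is_basic_partition G \<A> P)"

text \<open>The partition is determined by the S-ring; see \<open>basic_sets_eqI\<close> below.\<close>

definition basic_sets :: "('a, 'b) monoid_scheme \<Rightarrow> ('a \<Rightarrow> int) set \<Rightarrow> 'a set set" where
  "basic_sets G \<A> = (THE P. is_basic_partition G \<A> P)"

definition A_group :: "('a, 'b) monoid_scheme \<Rightarrow> ('a \<Rightarrow> int) set \<Rightarrow> 'a set \<Rightarrow> bool" where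
  "A_group G \<A> H \<longleftrightarrow> subgroup H G \<and> (\<exists>\<C>\<subseteq>basic_sets G \<A>. H = \<Union>\<C>)"

definition section_group :: "('a, 'b) monoid_scheme \<Rightarrow> 'a set \<Rightarrow> 'a set \<Rightarrow> 'a set monoid" where
  "section_group G U L = (G\<lparr>carrier := U\<rparr>) Mod L"

definition A_section ::
    "('a, 'b) monoid_scheme \<Rightarrow> ('a \<Rightarrow> int) set \<Rightarrow> 'a set \<Rightarrow> 'a set \<Rightarrow> bool" where
  "A_section G \<A> U L \<longleftrightarrow>
     A_group G \<A> U \<and> A_group G \<A> L \<and> L \<subseteq> U \<and> L \<lhd> (G\<lparr>carrier := U\<rparr>)"

text \<open>
  The S-ring over \<open>U/L\<close> spanned by the images of the basic sets contained in \<open>U\<close>; the quotient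
  epimorphism is \<open>x \<mapsto> L #> x\<close>.
\<close>

definition section_S_ring ::
    "('a, 'b) monoid_scheme \<Rightarrow> ('a \<Rightarrow> int) set \<Rightarrow> 'a set \<Rightarrow> 'a set \<Rightarrow> ('a set \<Rightarrow> int) set" where
  "section_S_ring G \<A> U L =
     int_span {(\<lambda>x. L #>\<^bsub>G\<^esub> x) ` X | X. X \<in> basic_sets G \<A> \<and> X \<subseteq> U}"

definition primitive_S_ring :: "('a, 'b) monoid_scheme \<Rightarrow> ('a \<Rightarrow> int) set \<Rightarrow> bool" where
  "primitive_S_ring G \<A> \<longleftrightarrow>
     S_ring G \<A> \<and> \<not> trivial_group G \<and>
     (\<forall>H. A_group G \<A> H \<longrightarrow> H = {\<one>\<^bsub>G\<^esub>} \<or> H = carrier G)"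

definition quasidense :: "('a, 'b) monoid_scheme \<Rightarrow> ('a \<Rightarrow> int) set \<Rightarrow> bool" where
  "quasidense G \<A> \<longleftrightarrow>
     S_ring G \<A> \<and>
     (\<forall>U L. A_section G \<A> U L \<and> primitive_S_ring (section_group G U L) (section_S_ring G \<A> U L)
        \<longrightarrow> Factorial_Ring.prime (order (section_group G U L)))"

definition coset_S_ring :: "('a, 'b) monoid_scheme \<Rightarrow> ('a \<Rightarrow> int) set \<Rightarrow> bool" where
  "coset_S_ring G \<A> \<longleftrightarrow>
     S_ring G \<A> \<and>
     (\<forall>X\<in>basic_sets G \<A>. \<exists>H. subgroup H G \<and> X \<in> rcosets\<^bsub>G\<^esub> H)"

lemma group_ring_mult:
  assumes "group G" "finite (carrier G)" "z \<in> carrier G"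
  shows "(f \<otimes>\<^bsub>group_ring G\<^esub> g) z = (\<Sum>x\<in>carrier G. f x * g (inv\<^bsub>G\<^esub> x \<otimes>\<^bsub>G\<^esub> z))"
proof -
  interpret group G by fact
  have "(f \<otimes>\<^bsub>group_ring G\<^esub> g) z = (\<Sum>(x, y) \<in> {(x, y). x \<in> carrier G \<and> y \<in> carrier G \<and> x \<otimes>\<^bsub>G\<^esub> y = z}. f x * g y)"
    by (simp add: group_ring_def)
  also have "\<dots> = (\<Sum>x\<in>carrier G. f x * g (inv\<^bsub>G\<^esub> x \<otimes>\<^bsub>G\<^esub> z))"
    by (rule sum.reindex_bij_witness[where i="\<lambda>x. (x, inv\<^bsub>G\<^esub> x \<otimes>\<^bsub>G\<^esub> z)" and j=fst])
       (use assms in \<open>auto simp: m_assoc[symmetric]\<close>)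
  finally show ?thesis .
qed

lemma group_ring_mult_out:
  assumes "group G" "z \<notin> carrier G"
  shows "(f \<otimes>\<^bsub>group_ring G\<^esub> g) z = 0"
proof -
  interpret group G by fact
  have "{(x, y). x \<in> carrier G \<and> y \<in> carrier G \<and> x \<otimes>\<^bsub>G\<^esub> y = z} = {}" using assms by auto
  then have "(\<Sum>(x, y) \<in> {(x, y). x \<in> carrier G \<and> y \<in> carrier G \<and> x \<otimes>\<^bsub>G\<^esub> y = z}. f x * g y) = 0" by (simp only: sum.empty)
  then show ?thesis unfolding group_ring_def by simp
qed

lemma ring_group_ring:
  assumes "group G" "finite (carrier G)"
  shows "ring (group_ring G)"
proof -
  interpret group G by fact
  let ?R = "group_ring G"
  note fin = assms(2)
  have c: "f \<in> carrier ?R \<longleftrightarrow> (\<forall>x. x \<notin> carrier G \<longrightarrow> f x = 0)" for f by (simp add: group_ring_def)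
  have add: "f \<oplus>\<^bsub>?R\<^esub> g = (\<lambda>x. f x + g x)" for f g by (simp add: group_ring_def)
  have o: "\<one>\<^bsub>?R\<^esub> = (\<lambda>x. if x = \<one>\<^bsub>G\<^esub> then 1 else 0)" by (simp add: group_ring_def)
  have z: "\<zero>\<^bsub>?R\<^esub> = (\<lambda>x. 0)" by (simp add: group_ring_def)
  have mi: "(f \<otimes>\<^bsub>?R\<^esub> g) z = (\<Sum>x\<in>carrier G. f x * g (inv\<^bsub>G\<^esub> x \<otimes>\<^bsub>G\<^esub> z))" if "z \<in> carrier G" for f g z
    by (rule group_ring_mult[OF assms that])
  have mo: "(f \<otimes>\<^bsub>?R\<^esub> g) z = 0" if "z \<notin> carrier G" for f g z by (rule group_ring_mult_out[OF assms(1) that])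
  show ?thesis
  proof (rule ringI)
    show "abelian_group ?R"
    proof (rule abelian_groupI)
      fix f assume "f \<in> carrier ?R"
      then show "\<exists>g\<in>carrier ?R. g \<oplus>\<^bsub>?R\<^esub> f = \<zero>\<^bsub>?R\<^esub>"
        by (intro bexI[of _ "\<lambda>x. - f x"]) (auto simp: c add z)
    qed (auto simp: c add z algebra_simps)
    show "Group.monoid ?R"
    proof
      fix f g assume "f \<in> carrier ?R" "g \<in> carrier ?R"
      then show "f \<otimes>\<^bsub>?R\<^esub> g \<in> carrier ?R" by (auto simp: c mo)
    next
      show "\<one>\<^bsub>?R\<^esub> \<in> carrier ?R" by (auto simp: c o)
    next
      fix f assume f: "f \<in> carrier ?R"
      have "(\<one>\<^bsub>?R\<^esub> \<otimes>\<^bsub>?R\<^esub> f) z = f z" for z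
      proof (cases "z \<in> carrier G")
        case True
        have "(\<one>\<^bsub>?R\<^esub> \<otimes>\<^bsub>?R\<^esub> f) z = (\<Sum>x\<in>carrier G. if x = \<one>\<^bsub>G\<^esub> then f z else 0)"
          unfolding mi[OF True] o using True by (intro sum.cong) auto
        then show ?thesis using fin by simp
      qed (use f in \<open>auto simp: c mo\<close>)
      then show "\<one>\<^bsub>?R\<^esub> \<otimes>\<^bsub>?R\<^esub> f = f" by blast
      have "(f \<otimes>\<^bsub>?R\<^esub> \<one>\<^bsub>?R\<^esub>) z = f z" for z
      proof (cases "z \<in> carrier G")
        case True
        have "inv\<^bsub>G\<^esub> x \<otimes>\<^bsub>G\<^esub> z = \<one>\<^bsub>G\<^esub> \<longleftrightarrow> x = z" if "x \<in> carrier G" for x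
          using that True by (metis inv_closed inv_equality inv_inv l_inv)
        then have "(f \<otimes>\<^bsub>?R\<^esub> \<one>\<^bsub>?R\<^esub>) z = (\<Sum>x\<in>carrier G. if x = z then f z else 0)"
          unfolding mi[OF True] o by (intro sum.cong) auto
        then show ?thesis using fin True by simp
      qed (use f in \<open>auto simp: c mo\<close>)
      then show "f \<otimes>\<^bsub>?R\<^esub> \<one>\<^bsub>?R\<^esub> = f" by blast
    next
      fix f g h assume "f \<in> carrier ?R" "g \<in> carrier ?R" "h \<in> carrier ?R"
      show "f \<otimes>\<^bsub>?R\<^esub> g \<otimes>\<^bsub>?R\<^esub> h = f \<otimes>\<^bsub>?R\<^esub> (g \<otimes>\<^bsub>?R\<^esub> h)"
      proof
        fix z show "(f \<otimes>\<^bsub>?R\<^esub> g \<otimes>\<^bsub>?R\<^esub> h) z = (f \<otimes>\<^bsub>?R\<^esub> (g \<otimes>\<^bsub>?R\<^esub> h)) z"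
        proof (cases "z \<in> carrier G")
          case True
          have "(f \<otimes>\<^bsub>?R\<^esub> g \<otimes>\<^bsub>?R\<^esub> h) z = (\<Sum>x\<in>carrier G. \<Sum>y\<in>carrier G. f y * g (inv\<^bsub>G\<^esub> y \<otimes>\<^bsub>G\<^esub> x) * h (inv\<^bsub>G\<^esub> x \<otimes>\<^bsub>G\<^esub> z))"
            by (simp add: mi True sum_distrib_right)
          also have "\<dots> = (\<Sum>y\<in>carrier G. \<Sum>x\<in>carrier G. f y * g (inv\<^bsub>G\<^esub> y \<otimes>\<^bsub>G\<^esub> x) * h (inv\<^bsub>G\<^esub> x \<otimes>\<^bsub>G\<^esub> z))"
            by (rule sum.swap)
          also have "\<dots> = (\<Sum>y\<in>carrier G. \<Sum>x\<in>carrier G. f y * (g x * h (inv\<^bsub>G\<^esub> x \<otimes>\<^bsub>G\<^esub> (inv\<^bsub>G\<^esub> y \<otimes>\<^bsub>G\<^esub> z))))"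
          proof (rule sum.cong[OF refl])
            fix y assume y: "y \<in> carrier G"
            have yy: "a \<otimes>\<^bsub>G\<^esub> y \<otimes>\<^bsub>G\<^esub> inv\<^bsub>G\<^esub> y \<otimes>\<^bsub>G\<^esub> z = a \<otimes>\<^bsub>G\<^esub> z" if "a \<in> carrier G" for a
              using that y True by (simp add: m_assoc)
            show "(\<Sum>x\<in>carrier G. f y * g (inv\<^bsub>G\<^esub> y \<otimes>\<^bsub>G\<^esub> x) * h (inv\<^bsub>G\<^esub> x \<otimes>\<^bsub>G\<^esub> z)) =
              (\<Sum>x\<in>carrier G. f y * (g x * h (inv\<^bsub>G\<^esub> x \<otimes>\<^bsub>G\<^esub> (inv\<^bsub>G\<^esub> y \<otimes>\<^bsub>G\<^esub> z))))"
              by (rule sum.reindex_bij_witness[where i="\<lambda>x. y \<otimes>\<^bsub>G\<^esub> x" and j="\<lambda>x. inv\<^bsub>G\<^esub> y \<otimes>\<^bsub>G\<^esub> x"])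
                 (use y True in \<open>auto simp: m_assoc[symmetric] inv_mult_group yy\<close>)
          qed
          also have "\<dots> = (f \<otimes>\<^bsub>?R\<^esub> (g \<otimes>\<^bsub>?R\<^esub> h)) z"
            by (simp add: mi True sum_distrib_left)
          finally show ?thesis .
        qed (simp add: mo)
      qed
    qed
  next
    fix f g h assume "f \<in> carrier ?R" "g \<in> carrier ?R" "h \<in> carrier ?R"
    show "(f \<oplus>\<^bsub>?R\<^esub> g) \<otimes>\<^bsub>?R\<^esub> h = f \<otimes>\<^bsub>?R\<^esub> h \<oplus>\<^bsub>?R\<^esub> g \<otimes>\<^bsub>?R\<^esub> h"
    proof
      fix z show "((f \<oplus>\<^bsub>?R\<^esub> g) \<otimes>\<^bsub>?R\<^esub> h) z = (f \<otimes>\<^bsub>?R\<^esub> h \<oplus>\<^bsub>?R\<^esub> g \<otimes>\<^bsub>?R\<^esub> h) z"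
        by (cases "z \<in> carrier G") (auto simp: mi mo add algebra_simps sum.distrib)
    qed
    show "h \<otimes>\<^bsub>?R\<^esub> (f \<oplus>\<^bsub>?R\<^esub> g) = h \<otimes>\<^bsub>?R\<^esub> f \<oplus>\<^bsub>?R\<^esub> h \<otimes>\<^bsub>?R\<^esub> g"
    proof
      fix z show "(h \<otimes>\<^bsub>?R\<^esub> (f \<oplus>\<^bsub>?R\<^esub> g)) z = (h \<otimes>\<^bsub>?R\<^esub> f \<oplus>\<^bsub>?R\<^esub> h \<otimes>\<^bsub>?R\<^esub> g) z"
        by (cases "z \<in> carrier G") (auto simp: mi mo add algebra_simps sum.distrib)
    qed
  qed
qed

lemma int_span_value:
  assumes "finite (carrier G)" "partition_on (carrier G) P" "X \<in> P" "x \<in> X"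
  shows "(\<Sum>Y\<in>P. c Y * simple_quantity Y x) = c X"
proof -
  have fin: "finite P" using assms by (metis finite_UnionD partition_onD1)
  have "c Y * simple_quantity Y x = (if Y = X then c X else 0)" if "Y \<in> P" for Y
  proof (cases "Y = X")
    case True then show ?thesis using assms by (simp add: simple_quantity_def)
  next
    case False
    then have "Y \<inter> X = {}"
      using assms that by (metis disjointD partition_onD2)
    then show ?thesis using False assms by (auto simp: simple_quantity_def)
  qed
  then have "(\<Sum>Y\<in>P. c Y * simple_quantity Y x) = (\<Sum>Y\<in>P. if Y = X then c X else 0)"
    by (rule sum.cong[OF refl])
  then show ?thesis using fin assms by (simp add: sum.delta)
qed

lemma simple_quantity_in_int_span:
  assumes "finite P" "X \<in> P"
  shows "simple_quantity X \<in> int_span P"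
proof -
  have "simple_quantity X = (\<lambda>x. \<Sum>Y\<in>P. (if Y = X then 1 else 0) * simple_quantity Y x)"
  proof
    fix x
    have "(\<Sum>Y\<in>P. (if Y = X then 1 else 0) * simple_quantity Y x) = (\<Sum>Y\<in>P. if Y = X then simple_quantity X x else 0)"
      by (rule sum.cong) auto
    then show "simple_quantity X x = (\<Sum>Y\<in>P. (if Y = X then 1 else 0) * simple_quantity Y x)"
      using assms by (simp add: sum.delta)
  qed
  then show ?thesis unfolding int_span_def mem_Collect_eq by (rule exI[where x="\<lambda>Y. if Y = X then 1 else 0"])
qed

lemma int_span_refines:
  assumes fin: "finite (carrier G)"
    and P: "partition_on (carrier G) P" and Q: "partition_on (carrier G) Q"
    and PQ: "int_span P \<subseteq> int_span Q"
    and X: "X \<in> P" and Y: "Y \<in> Q" and x: "x \<in> X" "x \<in> Y"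
  shows "Y \<subseteq> X"
proof
  fix y assume y: "y \<in> Y"
  have "finite P" using fin P by (metis finite_UnionD partition_onD1)
  then have "simple_quantity X \<in> int_span Q" using simple_quantity_in_int_span X PQ by blast
  then obtain c where c: "simple_quantity X = (\<lambda>x. \<Sum>Z\<in>Q. c Z * simple_quantity Z x)"
    unfolding int_span_def by blast
  have "simple_quantity X x = c Y" "simple_quantity X y = c Y"
    unfolding c using int_span_value[OF fin Q Y] x y by auto
  then show "y \<in> X" using x by (auto simp: simple_quantity_def split: if_splits)
qed

lemma basic_partition_subset:
  assumes fin: "finite (carrier G)"
    and P: "is_basic_partition G \<A> P" and Q: "is_basic_partition G \<A> Q"
  shows "P \<subseteq> Q"
proof
  fix X assume X: "X \<in> P"
  have p: "partition_on (carrier G) P" "partition_on (carrier G) Q" "int_span P = int_span Q"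
    using P Q by (auto simp: is_basic_partition_def)
  obtain x where x: "x \<in> X" using X p(1) by (metis ex_in_conv partition_onD3)
  then obtain Y where Y: "Y \<in> Q" "x \<in> Y" using X p by (metis UnionI UnionE partition_onD1)
  have "Y \<subseteq> X" using int_span_refines[OF fin p(1,2) _ X Y(1) x Y(2)] p(3) by simp
  moreover have "X \<subseteq> Y" using int_span_refines[OF fin p(2,1) _ Y(1) X Y(2) x] p(3) by simp
  ultimately show "X \<in> Q" using Y by auto
qed

lemma basic_sets_eqI:
  assumes "finite (carrier G)" "is_basic_partition G \<A> P"
  shows "basic_sets G \<A> = P"
  unfolding basic_sets_def
  using assms basic_partition_subset by (metis (mono_tags, lifting) subset_antisym the_equality)

end

theory Submission
  imports Defs
begin

text \<open>
  Let \<open>\<A> = \<Inter>\<F>\<close> and let \<open>X\<close> be a basic set of \<open>\<A>\<close>. A set is a union of basic sets of \<open>\<A>\<close> iff it is a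
  union of basic sets of each member of \<open>\<F>\<close>, so \<open>X\<close> is obtained by gluing together cosets, the
  basic sets of the members. It has to be shown that the glued set is again a coset.

  A quasidense S-ring \<open>\<B> \<subseteq> \<A>\<close> provides a chain of subgroups from the trivial group to \<open>G\<close>
  in which all steps have prime index and all terms are unions of basic sets of \<open>\<A>\<close>: between two
  consecutive \<open>\<B>\<close>-groups \<open>L\<close> and \<open>U\<close> the section \<open>U/L\<close> is primitive (\<open>primitive_section\<close>). Going
  down this chain, one proves that \<open>X <#> L\<close> is a coset. For \<open>L = G\<close> this is trivial, and for \<open>L\<close> trivial it is the claim.

  For the step from \<open>U\<close> to \<open>L\<close> (\<open>coset_step\<close>), the decisive fact is that in a cyclic group with \<open>U/L\<close>
  of prime order, all subgroups that contain \<open>L\<close> but not \<open>U\<close> lie in one subgroup \<open>Q\<close> with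
  \<open>Q \<inter> U = L\<close> (\<open>cyclic_prime_quotient_complement\<close>). Either \<open>X <#> L\<close> contains a coset of \<open>U\<close> through a
  point of \<open>X\<close>, and then \<open>X <#> L = X <#> U\<close>; or all the cosets glued to form \<open>X\<close> are cosets of
  subgroups of \<open>Q\<close>, so that \<open>X\<close> stays inside one coset of \<open>Q\<close> and \<open>X <#> L\<close> is the intersection of
  that coset with \<open>X <#> U\<close>. In both cases \<open>X <#> L\<close> is a coset.
\<close>

section \<open>S-rings as partitions\<close>

lemma mem_int_span_iff:
  assumes fin: "finite (carrier G)" and P: "partition_on (carrier G) P"
  shows "f \<in> int_span P \<longleftrightarrow>
    (\<forall>x. x \<notin> carrier G \<longrightarrow> f x = 0) \<and> (\<forall>X\<in>P. \<forall>x\<in>X. \<forall>y\<in>X. f x = f y)"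
proof
  assume "f \<in> int_span P"
  then obtain c where c: "f = (\<lambda>x. \<Sum>X\<in>P. c X * simple_quantity X x)"
    unfolding int_span_def by blast
  have "f x = 0" if "x \<notin> carrier G" for x
    unfolding c using that partition_onD1[OF P] by (intro sum.neutral) (auto simp: simple_quantity_def)
  moreover have "f x = f y" if "X \<in> P" "x \<in> X" "y \<in> X" for X x y
    unfolding c using int_span_value[OF fin P] that by simp
  ultimately show "(\<forall>x. x \<notin> carrier G \<longrightarrow> f x = 0) \<and> (\<forall>X\<in>P. \<forall>x\<in>X. \<forall>y\<in>X. f x = f y)" by blast
next
  assume f: "(\<forall>x. x \<notin> carrier G \<longrightarrow> f x = 0) \<and> (\<forall>X\<in>P. \<forall>x\<in>X. \<forall>y\<in>X. f x = f y)"
  define c where "c X = f (SOME x. x \<in> X)" for X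
  have "f x = (\<Sum>X\<in>P. c X * simple_quantity X x)" for x
  proof (cases "x \<in> carrier G")
    case True
    then obtain X where X: "X \<in> P" "x \<in> X" using partition_onD1[OF P] by blast
    then have "c X = f x" unfolding c_def using f someI[of "\<lambda>x. x \<in> X"] by blast
    then show ?thesis using int_span_value[OF fin P X] by simp
  next
    case False
    then show ?thesis
      using f partition_onD1[OF P] by (auto simp: simple_quantity_def intro!: sum.neutral[symmetric])
  qed
  then show "f \<in> int_span P" unfolding int_span_def by blast
qed

text \<open>
  Once the unit element forms a class of its own, closure under multiplication is the one ring
  condition that does not hold automatically for the span of a partition.
\<close>

lemma S_ringI:
  assumes G: "group G" and fin: "finite (carrier G)"
    and part: "partition_on (carrier G) P" and one: "{\<one>\<^bsub>G\<^esub>} \<in> P"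
    and inv: "\<And>X. X \<in> P \<Longrightarrow> set_inv\<^bsub>G\<^esub> X \<in> P"
    and mult: "\<And>f g. f \<in> int_span P \<Longrightarrow> g \<in> int_span P \<Longrightarrow> f \<otimes>\<^bsub>group_ring G\<^esub> g \<in> int_span P"
  shows "S_ring G (int_span P)" and "basic_sets G (int_span P) = P"
proof -
  interpret R: ring "group_ring G" by (rule ring_group_ring[OF G fin])
  note iff = mem_int_span_iff[OF fin part]
  have basic: "is_basic_partition G (int_span P) P"
    unfolding is_basic_partition_def using part one inv by blast
  then show "basic_sets G (int_span P) = P" by (rule basic_sets_eqI[OF fin])
  have sub: "int_span P \<subseteq> carrier (group_ring G)"
    unfolding subset_iff iff by (simp add: group_ring_def)
  have "subring (int_span P) (group_ring G)"
  proof (rule R.subringI[OF sub])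
    have "\<one>\<^bsub>group_ring G\<^esub> = simple_quantity {\<one>\<^bsub>G\<^esub>}"
      by (auto simp: group_ring_def simple_quantity_def)
    moreover have "finite P" using fin part by (metis finite_UnionD partition_onD1)
    ultimately show "\<one>\<^bsub>group_ring G\<^esub> \<in> int_span P"
      using simple_quantity_in_int_span[OF _ one] by simp
  next
    fix f assume f: "f \<in> int_span P"
    have "(\<lambda>x. - f x) \<oplus>\<^bsub>group_ring G\<^esub> f = \<zero>\<^bsub>group_ring G\<^esub>" by (simp add: group_ring_def)
    moreover have "(\<lambda>x. - f x) \<in> carrier (group_ring G)"
      using f[unfolded iff] by (simp add: group_ring_def)
    ultimately have eq: "\<ominus>\<^bsub>group_ring G\<^esub> f = (\<lambda>x. - f x)"
      using R.minus_equality f sub by blast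
    have "- f x = - f y" if "X \<in> P" "x \<in> X" "y \<in> X" for X x y
      using f[unfolded iff] that by (intro arg_cong[where f=uminus]) blast
    moreover have "- f x = 0" if "x \<notin> carrier G" for x
      using f[unfolded iff] that by simp
    ultimately show "\<ominus>\<^bsub>group_ring G\<^esub> f \<in> int_span P"
      unfolding iff eq by blast
  next
    fix f g assume fg: "f \<in> int_span P" "g \<in> int_span P"
    have eq: "f \<oplus>\<^bsub>group_ring G\<^esub> g = (\<lambda>x. f x + g x)" by (simp add: group_ring_def)
    have "f x + g x = f y + g y" if "X \<in> P" "x \<in> X" "y \<in> X" for X x y
      using fg[unfolded iff] that by (intro arg_cong2[where f="(+)"]) blast+
    moreover have "f x + g x = 0" if "x \<notin> carrier G" for x
      using fg[unfolded iff] that by simp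
    ultimately show "f \<oplus>\<^bsub>group_ring G\<^esub> g \<in> int_span P"
      unfolding iff eq by blast
  qed (rule mult)
  then show "S_ring G (int_span P)" unfolding S_ring_def using basic by blast
qed

text \<open>
  Membership in an S-ring is constancy on basic sets, so most arguments about \<open>\<A>\<close> can be
  carried out on sets instead of ring elements. The predicate \<open>A_set\<close> below describes the unions of
  basic sets; on this level multiplication in the ring becomes the product of sets.
\<close>

locale abelian_S_ring = comm_group G for G (structure) +
  fixes \<A> :: "('a \<Rightarrow> int) set"
  assumes finite_carrier: "finite (carrier G)"
    and S_ring: "S_ring G \<A>"
begin

abbreviation "basic \<equiv> basic_sets G \<A>"

lemma is_basic_partition: "is_basic_partition G \<A> basic"
  using S_ring basic_sets_eqI[OF finite_carrier] unfolding S_ring_def by metis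

lemma basic_partition: "partition_on (carrier G) basic"
  and one_basic: "{\<one>} \<in> basic"
  and inv_basic: "X \<in> basic \<Longrightarrow> set_inv X \<in> basic"
  and span_basic: "\<A> = int_span basic"
  using is_basic_partition unfolding is_basic_partition_def by blast+

lemma mem_iff:
  "f \<in> \<A> \<longleftrightarrow> (\<forall>x. x \<notin> carrier G \<longrightarrow> f x = 0) \<and> (\<forall>X\<in>basic. \<forall>x\<in>X. \<forall>y\<in>X. f x = f y)"
  using mem_int_span_iff[OF finite_carrier basic_partition] span_basic by simp

lemma const_on_basic: "f \<in> \<A> \<Longrightarrow> X \<in> basic \<Longrightarrow> x \<in> X \<Longrightarrow> y \<in> X \<Longrightarrow> f x = f y"
  and zero_outside: "f \<in> \<A> \<Longrightarrow> x \<notin> carrier G \<Longrightarrow> f x = 0"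
  unfolding mem_iff by blast+

lemma mult_mem: "f \<in> \<A> \<Longrightarrow> g \<in> \<A> \<Longrightarrow> f \<otimes>\<^bsub>group_ring G\<^esub> g \<in> \<A>"
  using S_ring subringE(6) unfolding S_ring_def by metis

lemma basic_subset: "X \<in> basic \<Longrightarrow> X \<subseteq> carrier G"
  using partition_onD1[OF basic_partition] by blast

lemma basic_nonempty: "X \<in> basic \<Longrightarrow> X \<noteq> {}"
  using partition_onD3[OF basic_partition] by blast

lemma basic_cover: "x \<in> carrier G \<Longrightarrow> \<exists>X\<in>basic. x \<in> X"
  using partition_onD1[OF basic_partition] by blast

lemma basic_eqI: "X \<in> basic \<Longrightarrow> Y \<in> basic \<Longrightarrow> x \<in> X \<Longrightarrow> x \<in> Y \<Longrightarrow> X = Y"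
  using partition_onD2[OF basic_partition] by (metis IntI disjointD empty_iff)

definition A_set :: "'a set \<Rightarrow> bool" where
  "A_set Y \<longleftrightarrow> Y \<subseteq> carrier G \<and> simple_quantity Y \<in> \<A>"

lemma A_set_iff:
  "A_set Y \<longleftrightarrow> Y \<subseteq> carrier G \<and> (\<forall>X\<in>basic. X \<inter> Y \<noteq> {} \<longrightarrow> X \<subseteq> Y)"
proof -
  have "(\<forall>x\<in>X. \<forall>y\<in>X. simple_quantity Y x = simple_quantity Y y) \<longleftrightarrow> (X \<inter> Y \<noteq> {} \<longrightarrow> X \<subseteq> Y)" for X
    by (auto simp: simple_quantity_def)
  then show ?thesis unfolding A_set_def mem_iff by (auto simp: simple_quantity_def)
qed

lemma A_setD: "A_set Y \<Longrightarrow> X \<in> basic \<Longrightarrow> x \<in> X \<Longrightarrow> x \<in> Y \<Longrightarrow> X \<subseteq> Y"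
  unfolding A_set_iff by blast

lemma A_set_subset: "A_set Y \<Longrightarrow> Y \<subseteq> carrier G" by (simp add: A_set_def)

lemma A_set_basic: "X \<in> basic \<Longrightarrow> A_set X"
  unfolding A_set_iff using basic_eqI basic_subset by blast

lemma A_set_compl: "A_set Y \<Longrightarrow> A_set (carrier G - Y)"
  unfolding A_set_iff using basic_subset by blast

lemma A_set_support: "f \<in> \<A> \<Longrightarrow> A_set {x. f x \<noteq> 0}"
proof -
  assume f: "f \<in> \<A>"
  have "X \<subseteq> {x. f x \<noteq> 0}" if X: "X \<in> basic" and ne: "X \<inter> {x. f x \<noteq> 0} \<noteq> {}" for X
  proof
    fix y assume y: "y \<in> X"
    obtain x where x: "x \<in> X" "f x \<noteq> 0" using ne by blast
    have "f y = f x" by (rule const_on_basic[OF f X y x(1)])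
    then show "y \<in> {x. f x \<noteq> 0}" using x by simp
  qed
  moreover have "{x. f x \<noteq> 0} \<subseteq> carrier G" using zero_outside[OF f] by blast
  ultimately show ?thesis unfolding A_set_iff by blast
qed

text \<open>
  The product of the two simple quantities counts the factorizations of an element; it is nonzero
  exactly on the product set, because all terms are nonnegative.
\<close>

lemma A_set_mult:
  assumes X: "A_set X" and Y: "A_set Y"
  shows "A_set (X <#> Y)"
proof -
  note sub = A_set_subset[OF X] A_set_subset[OF Y]
  let ?f = "simple_quantity X \<otimes>\<^bsub>group_ring G\<^esub> simple_quantity Y"
  have f: "?f \<in> \<A>" using mult_mem X Y by (simp add: A_set_def)
  have "{z. ?f z \<noteq> 0} = X <#> Y"
  proof (rule Set.set_eqI)
    fix z
    show "z \<in> {z. ?f z \<noteq> 0} \<longleftrightarrow> z \<in> X <#> Y"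
    proof (cases "z \<in> carrier G")
      case True
      have "?f z = (\<Sum>x\<in>carrier G. simple_quantity X x * simple_quantity Y (inv x \<otimes> z))"
        by (rule group_ring_mult[OF is_group finite_carrier True])
      then have "?f z \<noteq> 0 \<longleftrightarrow> (\<exists>x\<in>carrier G. simple_quantity X x * simple_quantity Y (inv x \<otimes> z) \<noteq> 0)"
        using finite_carrier by (simp add: sum_nonneg_eq_0_iff simple_quantity_def)
      also have "\<dots> \<longleftrightarrow> (\<exists>x\<in>X. inv x \<otimes> z \<in> Y)"
        using sub by (auto simp: simple_quantity_def)
      also have "\<dots> \<longleftrightarrow> z \<in> X <#> Y"
      proof
        assume "\<exists>x\<in>X. inv x \<otimes> z \<in> Y"
        then obtain x where x: "x \<in> X" "inv x \<otimes> z \<in> Y" by blast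
        then have "x \<in> carrier G" using sub by blast
        then have "x \<otimes> (inv x \<otimes> z) = z" using True by (simp add: m_assoc[symmetric])
        then show "z \<in> X <#> Y" unfolding set_mult_def using x by force
      next
        assume "z \<in> X <#> Y"
        then obtain x y where xy: "x \<in> X" "y \<in> Y" "z = x \<otimes> y" unfolding set_mult_def by blast
        then have "x \<in> carrier G" "y \<in> carrier G" using sub by blast+
        then have "inv x \<otimes> z = y" using xy by (simp add: m_assoc[symmetric])
        then show "\<exists>x\<in>X. inv x \<otimes> z \<in> Y" using xy by blast
      qed
      finally show ?thesis by simp
    next
      case False
      moreover have "X <#> Y \<subseteq> carrier G" using sub by (rule setmult_subset_G)
      moreover have "?f z = 0" by (rule zero_outside[OF f False])
      ultimately show ?thesis by blast
    qed
  qed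
  then show ?thesis using A_set_support[OF f] by simp
qed

lemma A_group_iff: "A_group G \<A> H \<longleftrightarrow> subgroup H G \<and> A_set H"
proof
  assume H: "A_group G \<A> H"
  then obtain C where C: "C \<subseteq> basic" "H = \<Union>C" unfolding A_group_def by blast
  have "X \<subseteq> H" if X: "X \<in> basic" and ne: "X \<inter> H \<noteq> {}" for X
  proof -
    obtain x Y where "x \<in> X" "x \<in> Y" "Y \<in> C" using ne C by blast
    then show ?thesis using basic_eqI[OF X] C by blast
  qed
  moreover have "H \<subseteq> carrier G" using C basic_subset by blast
  ultimately show "subgroup H G \<and> A_set H"
    using H unfolding A_set_iff A_group_def by blast
next
  assume H: "subgroup H G \<and> A_set H"
  have "h \<in> \<Union>{X\<in>basic. X \<subseteq> H}" if h: "h \<in> H" for h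
  proof -
    have "h \<in> carrier G" using H h A_set_subset by blast
    then obtain X where X: "X \<in> basic" "h \<in> X" using basic_cover by blast
    then have "X \<subseteq> H" using A_setD H h by blast
    then show ?thesis using X by blast
  qed
  then have "H = \<Union>{X\<in>basic. X \<subseteq> H}" by blast
  moreover have "{X\<in>basic. X \<subseteq> H} \<subseteq> basic" by blast
  ultimately show "A_group G \<A> H" unfolding A_group_def using H by metis
qed

end

section \<open>Sections of an S-ring\<close>

locale abelian_S_ring_section = abelian_S_ring +
  fixes U L
  assumes A_group_U: "A_group G \<A> U" and A_group_L: "A_group G \<A> L" and L_subset_U: "L \<subseteq> U"
begin

abbreviation "Sec \<equiv> section_group G U L"
abbreviation "proj \<equiv> \<lambda>x. L #> x"
abbreviation "images \<equiv> {proj ` X | X. X \<in> basic \<and> X \<subseteq> U}"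

lemma U: "subgroup U G" "A_set U" and L: "subgroup L G" "A_set L"
  using A_group_U A_group_L by (simp_all add: A_group_iff)

lemma U_carrier: "x \<in> U \<Longrightarrow> x \<in> carrier G"
  using subgroup.mem_carrier[OF U(1)] .

lemma L_normal: "L \<lhd> (G\<lparr>carrier := U\<rparr>)"
  using normal_restrict_supergroup[OF U(1) subgroup_imp_normal[OF L(1)] L_subset_U] .

lemma A_section: "A_section G \<A> U L"
  unfolding A_section_def using A_group_U A_group_L L_subset_U L_normal by blast

lemma proj_hom: "group_hom (G\<lparr>carrier := U\<rparr>) Sec proj"
proof -
  have "(\<lambda>x. L #>\<^bsub>G\<lparr>carrier := U\<rparr>\<^esub> x) \<in> hom (G\<lparr>carrier := U\<rparr>) Sec"
    unfolding section_group_def by (rule normal.r_coset_hom_Mod[OF L_normal])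
  then have "proj \<in> hom (G\<lparr>carrier := U\<rparr>) Sec" by (simp add: r_coset_def)
  then show ?thesis
    by (intro group_hom.intro group_hom_axioms.intro subgroup_imp_group[OF U(1)])
       (simp_all add: section_group_def normal.factorgroup_is_group[OF L_normal])
qed

sublocale proj: group_hom "G\<lparr>carrier := U\<rparr>" Sec proj by (rule proj_hom)

lemma carrier_section: "carrier Sec = proj ` U"
  by (auto simp: section_group_def carrier_FactGroup r_coset_def)

lemma finite_section: "finite (carrier Sec)"
  unfolding carrier_section using finite_subset[OF A_set_subset[OF U(2)] finite_carrier] by simp

lemma proj_mult: "x \<in> U \<Longrightarrow> y \<in> U \<Longrightarrow> proj (x \<otimes> y) = proj x \<otimes>\<^bsub>Sec\<^esub> proj y"
  using proj.hom_mult by simp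

lemma proj_inv: "x \<in> U \<Longrightarrow> proj (inv x) = inv\<^bsub>Sec\<^esub> (proj x)"
  using proj.hom_inv[of x] m_inv_consistent[OF U(1)] by simp

lemma proj_one: "\<one>\<^bsub>Sec\<^esub> = L"
  by (simp add: section_group_def)

lemma card_fibre:
  assumes "C \<in> carrier Sec"
  shows "card {x\<in>U. proj x = C} = card L"
proof -
  obtain u where u: "u \<in> U" "C = proj u" using assms carrier_section by blast
  have "{x\<in>U. proj x = C} = C"
  proof
    show "{x\<in>U. proj x = C} \<subseteq> C" using rcos_self L(1) U_carrier by blast
  next
    show "C \<subseteq> {x\<in>U. proj x = C}"
    proof
      fix x assume x: "x \<in> C"
      then obtain l where "l \<in> L" "x = l \<otimes> u" using u unfolding r_coset_def by blast
      then have "x \<in> U" using u L_subset_U subgroup.m_closed[OF U(1)] by blast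
      moreover have "proj x = C"
        using repr_independence[OF _ U_carrier[OF u(1)] L(1)] x u by simp
      ultimately show "x \<in> {x\<in>U. proj x = C}" by blast
    qed
  qed
  moreover have "C \<in> rcosets L" unfolding RCOSETS_def using u U_carrier by blast
  ultimately show ?thesis
    using card_rcosets_equal A_set_subset[OF L(2)] by metis
qed

text \<open>
  If the images of two basic sets \<open>X\<close> and \<open>Y\<close> meet, then \<open>Y\<close> meets the A-set \<open>L <#> X\<close>, hence lies
  in it, so its image lies in that of \<open>X\<close>; by symmetry the two images are equal.
\<close>

lemma partition_images: "partition_on (carrier Sec) images"
proof (rule partition_onI)
  show "\<Union>images = carrier Sec"
  proof
    show "\<Union>images \<subseteq> carrier Sec" unfolding carrier_section by blast
    show "carrier Sec \<subseteq> \<Union>images"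
    proof
      fix C assume "C \<in> carrier Sec"
      then obtain u where u: "u \<in> U" "C = proj u" using carrier_section by blast
      obtain X where X: "X \<in> basic" "u \<in> X" using basic_cover U_carrier u by blast
      have "X \<subseteq> U" by (rule A_setD[OF U(2) X u(1)])
      then have "proj ` X \<in> images" using X by blast
      then show "C \<in> \<Union>images" using u X by blast
    qed
  qed
next
  show "{} \<notin> images" using basic_nonempty by blast
next
  have *: "proj ` Y \<subseteq> proj ` X"
    if X: "X \<in> basic" "X \<subseteq> U" and Y: "Y \<in> basic" "Y \<subseteq> U" and xy: "x \<in> X" "y \<in> Y" "proj x = proj y"
    for X Y x y
  proof -
    have "y \<in> proj x" using rcos_self[OF U_carrier L(1), of y] xy Y by auto
    then have "y \<in> L <#> X" unfolding r_coset_def set_mult_def using xy by blast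
    then have "Y \<subseteq> L <#> X" using A_setD[OF A_set_mult[OF L(2) A_set_basic[OF X(1)]] Y(1) xy(2)] by blast
    moreover have "proj (l \<otimes> x') \<in> proj ` X" if "l \<in> L" "x' \<in> X" for l x'
    proof -
      have "l \<otimes> x' \<in> proj x'" unfolding r_coset_def using that by blast
      then have "proj (l \<otimes> x') = proj x'"
        using repr_independence[OF _ _ L(1)] that X U_carrier by (metis subsetD)
      then show ?thesis using that by blast
    qed
    ultimately show ?thesis unfolding set_mult_def by blast
  qed
  fix p q assume p: "p \<in> images" and q: "q \<in> images" and "p \<noteq> q"
  obtain X where X: "X \<in> basic" "X \<subseteq> U" "p = proj ` X" using p by blast
  obtain Y where Y: "Y \<in> basic" "Y \<subseteq> U" "q = proj ` Y" using q by blast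
  show "disjnt p q"
  proof (rule ccontr)
    assume "\<not> disjnt p q"
    then obtain x y where "x \<in> X" "y \<in> Y" "proj x = proj y" unfolding disjnt_def X Y by blast
    then have "p = q" unfolding X(3) Y(3) using *[of X Y x y] *[of Y X y x] X Y by auto
    then show False using \<open>p \<noteq> q\<close> by blast
  qed
qed

lemma mem_span_images:
  "f \<in> int_span images \<longleftrightarrow> (\<forall>C. C \<notin> carrier Sec \<longrightarrow> f C = 0) \<and>
    (\<forall>X\<in>basic. X \<subseteq> U \<longrightarrow> (\<forall>x\<in>X. \<forall>y\<in>X. f (proj x) = f (proj y)))"
proof -
  have "(\<forall>Q\<in>images. R Q) \<longleftrightarrow> (\<forall>X\<in>basic. X \<subseteq> U \<longrightarrow> R (proj ` X))" for R by blast
  then show ?thesis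
    unfolding mem_int_span_iff[OF finite_section partition_images] by (simp only: ball_simps)
qed

text \<open>
  Pulling functions on \<open>U/L\<close> back to \<open>G\<close> multiplies convolution by the constant \<open>card L\<close>, the
  size of the fibres. This transfers closure under multiplication from \<open>\<A>\<close> to the section.
\<close>

definition lift :: "('a set \<Rightarrow> int) \<Rightarrow> 'a \<Rightarrow> int" where
  "lift f x = (if x \<in> U then f (proj x) else 0)"

lemma lift_mem:
  assumes f: "f \<in> int_span images"
  shows "lift f \<in> \<A>"
proof -
  have "lift f x = lift f y" if X: "X \<in> basic" "x \<in> X" "y \<in> X" for X x y
  proof (cases "X \<subseteq> U")
    case True
    then have "f (proj x) = f (proj y)" using f[unfolded mem_span_images] X by blast
    then show ?thesis unfolding lift_def using X True by auto
  next
    case False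
    then have "x \<notin> U" "y \<notin> U" using A_setD[OF U(2)] X by blast+
    then show ?thesis by (simp add: lift_def)
  qed
  moreover have "lift f x = 0" if "x \<notin> carrier G" for x
    using that U_carrier by (auto simp: lift_def)
  ultimately show ?thesis unfolding mem_iff by blast
qed

lemma lift_mult:
  assumes z: "z \<in> U"
  shows "(lift f \<otimes>\<^bsub>group_ring G\<^esub> lift g) z = int (card L) * (f \<otimes>\<^bsub>group_ring Sec\<^esub> g) (proj z)"
proof -
  have finU: "finite U" using finite_subset[OF A_set_subset[OF U(2)] finite_carrier] .
  let ?h = "\<lambda>C. f C * g (inv\<^bsub>Sec\<^esub> C \<otimes>\<^bsub>Sec\<^esub> proj z)"
  have "(lift f \<otimes>\<^bsub>group_ring G\<^esub> lift g) z = (\<Sum>x\<in>carrier G. lift f x * lift g (inv x \<otimes> z))"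
    by (rule group_ring_mult[OF is_group finite_carrier U_carrier[OF z]])
  also have "\<dots> = (\<Sum>x\<in>U. lift f x * lift g (inv x \<otimes> z))"
    using A_set_subset[OF U(2)] by (intro sum.mono_neutral_right finite_carrier) (auto simp: lift_def)
  also have "\<dots> = (\<Sum>x\<in>U. ?h (proj x))"
  proof (rule sum.cong[OF refl])
    fix x assume x: "x \<in> U"
    have "inv x \<in> U" using subgroup.m_inv_closed[OF U(1) x] .
    then show "lift f x * lift g (inv x \<otimes> z) = ?h (proj x)"
      using subgroup.m_closed[OF U(1) _ z] z x by (simp add: lift_def proj_mult proj_inv)
  qed
  also have "\<dots> = (\<Sum>C\<in>proj ` U. \<Sum>x\<in>{x\<in>U. proj x = C}. ?h (proj x))"
    by (rule sum.image_gen[OF finU])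
  also have "\<dots> = (\<Sum>C\<in>carrier Sec. int (card L) * ?h C)"
    unfolding carrier_section[symmetric]
  proof (rule sum.cong[OF refl])
    fix C assume C: "C \<in> carrier Sec"
    have "(\<Sum>x\<in>{x\<in>U. proj x = C}. ?h (proj x)) = (\<Sum>x\<in>{x\<in>U. proj x = C}. ?h C)"
      by (rule sum.cong) auto
    then show "(\<Sum>x\<in>{x\<in>U. proj x = C}. ?h (proj x)) = int (card L) * ?h C"
      using card_fibre[OF C] by simp
  qed
  also have "\<dots> = int (card L) * (f \<otimes>\<^bsub>group_ring Sec\<^esub> g) (proj z)"
    using group_ring_mult[OF proj.H.is_group finite_section] z carrier_section
    by (simp add: sum_distrib_left)
  finally show ?thesis .
qed

lemma section_mult:
  assumes f: "f \<in> int_span images" and g: "g \<in> int_span images"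
  shows "f \<otimes>\<^bsub>group_ring Sec\<^esub> g \<in> int_span images"
proof -
  let ?h = "f \<otimes>\<^bsub>group_ring Sec\<^esub> g"
  have lift: "lift f \<otimes>\<^bsub>group_ring G\<^esub> lift g \<in> \<A>" using lift_mem f g mult_mem by blast
  have "card L \<noteq> 0"
    using subgroup.one_closed[OF L(1)] finite_subset[OF A_set_subset[OF L(2)] finite_carrier] by auto
  then have "?h (proj x) = ?h (proj y)" if X: "X \<in> basic" "X \<subseteq> U" "x \<in> X" "y \<in> X" for X x y
  proof -
    have "(lift f \<otimes>\<^bsub>group_ring G\<^esub> lift g) x = (lift f \<otimes>\<^bsub>group_ring G\<^esub> lift g) y"
      by (rule const_on_basic[OF lift X(1,3,4)])
    moreover have "x \<in> U" "y \<in> U" using X by blast+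
    ultimately have "int (card L) * ?h (proj x) = int (card L) * ?h (proj y)"
      by (simp only: lift_mult)
    then show ?thesis using \<open>card L \<noteq> 0\<close> by simp
  qed
  moreover have "?h C = 0" if "C \<notin> carrier Sec" for C
    by (rule group_ring_mult_out[OF proj.H.is_group that])
  ultimately show ?thesis unfolding mem_span_images by blast
qed

lemma section_S_ring: "S_ring Sec (section_S_ring G \<A> U L)"
  and basic_section: "basic_sets Sec (section_S_ring G \<A> U L) = images"
proof -
  have one: "{\<one>\<^bsub>Sec\<^esub>} \<in> images"
  proof -
    have "proj \<one> = L" using coset_join2[OF one_closed L(1) subgroup.one_closed[OF L(1)]] .
    then have "{\<one>\<^bsub>Sec\<^esub>} = proj ` {\<one>}" by (simp add: proj_one)
    then show ?thesis using one_basic subgroup.one_closed[OF U(1)] by blast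
  qed
  have inv: "set_inv\<^bsub>Sec\<^esub> Q \<in> images" if Q: "Q \<in> images" for Q
  proof -
    obtain X where X: "X \<in> basic" "X \<subseteq> U" "Q = proj ` X" using Q by blast
    have "set_inv\<^bsub>Sec\<^esub> Q = (\<Union>x\<in>X. {inv\<^bsub>Sec\<^esub> (proj x)})" unfolding X SET_INV_def by blast
    also have "\<dots> = (\<Union>x\<in>X. {proj (inv x)})" using X(2) proj_inv by auto
    also have "\<dots> = proj ` (set_inv X)" unfolding SET_INV_def by blast
    finally have "set_inv\<^bsub>Sec\<^esub> Q = proj ` (set_inv X)" .
    moreover have "set_inv X \<subseteq> U" unfolding SET_INV_def using X subgroup.m_inv_closed[OF U(1)] by blast
    ultimately show ?thesis using inv_basic[OF X(1)] by blast
  qed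
  show "S_ring Sec (section_S_ring G \<A> U L)" "basic_sets Sec (section_S_ring G \<A> U L) = images"
    unfolding section_S_ring_def
    using S_ringI[OF proj.H.is_group finite_section partition_images one inv section_mult] by blast+
qed

lemma A_group_preimage:
  assumes K: "A_group Sec (section_S_ring G \<A> U L) K"
  defines "H \<equiv> {x\<in>U. proj x \<in> K}"
  shows "A_group G \<A> H" and "L \<subseteq> H" and "K = proj ` H"
proof -
  obtain C where sub: "subgroup K Sec" and C: "C \<subseteq> images" "K = \<Union>C"
    using K unfolding A_group_def basic_section by blast
  have "subgroup H G"
  proof (rule subgroupI)
    show "H \<subseteq> carrier G" unfolding H_def using U_carrier by blast
    have "\<one> \<in> U" using subgroup.one_closed[OF U(1)] .
    moreover have "proj \<one> \<in> K"
      using proj_one subgroup.one_closed[OF sub] coset_join2[OF one_closed L(1) subgroup.one_closed[OF L(1)]] by simp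
    ultimately show "H \<noteq> {}" unfolding H_def by blast
    show "inv a \<in> H" if "a \<in> H" for a
      using that subgroup.m_inv_closed[OF U(1)] subgroup.m_inv_closed[OF sub] by (simp add: H_def proj_inv)
    show "a \<otimes> b \<in> H" if "a \<in> H" "b \<in> H" for a b
      using that subgroup.m_closed[OF U(1)] subgroup.m_closed[OF sub] by (simp add: H_def proj_mult)
  qed
  moreover have "X \<subseteq> H" if X: "X \<in> basic" and x: "x \<in> X" "x \<in> H" for X x
  proof -
    have XU: "X \<subseteq> U" using A_setD[OF U(2) X] x by (auto simp: H_def)
    obtain Q where Q: "Q \<in> C" "proj x \<in> Q" using x C by (auto simp: H_def)
    have "proj ` X \<in> images" using X XU by blast
    then have "proj ` X = Q"
      using partition_onD2[OF partition_images] Q C x by (metis (no_types, lifting) IntI disjointD empty_iff imageI subsetD)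
    then show ?thesis using Q C XU by (auto simp: H_def)
  qed
  moreover have "H \<subseteq> carrier G" using U_carrier by (auto simp: H_def)
  ultimately show "A_group G \<A> H" unfolding A_group_iff A_set_iff by blast
  show "L \<subseteq> H"
  proof
    fix l assume l: "l \<in> L"
    then have "proj l = L" using coset_join2[OF _ L(1)] L_subset_U U_carrier by blast
    then show "l \<in> H" using l L_subset_U proj_one subgroup.one_closed[OF sub] by (auto simp: H_def)
  qed
  show "K = proj ` H"
    using subgroup.subset[OF sub] carrier_section by (auto simp: H_def)
qed

lemma primitive_section:
  assumes ne: "L \<noteq> U"
    and minimal: "\<And>H. A_group G \<A> H \<Longrightarrow> L \<subseteq> H \<Longrightarrow> H \<subseteq> U \<Longrightarrow> H = L \<or> H = U"
  shows "primitive_S_ring Sec (section_S_ring G \<A> U L)"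
  unfolding primitive_S_ring_def
proof (intro conjI allI impI)
  have projL: "proj ` L = {\<one>\<^bsub>Sec\<^esub>}"
    using coset_join2[OF _ L(1)] subgroup.one_closed[OF L(1)] L_subset_U U_carrier unfolding proj_one by blast
  show "S_ring Sec (section_S_ring G \<A> U L)" by (rule section_S_ring)
  show "\<not> trivial_group Sec"
  proof
    assume "trivial_group Sec"
    then have "carrier Sec = {L}" unfolding trivial_group_def proj_one by blast
    then have "proj u = L" if "u \<in> U" for u using that carrier_section by blast
    then have "U \<subseteq> L" using coset_join1[OF _ U_carrier L(1)] by blast
    then show False using ne L_subset_U by blast
  qed
  fix K assume K: "A_group Sec (section_S_ring G \<A> U L) K"
  let ?H = "{x\<in>U. proj x \<in> K}"
  have "?H = L \<or> ?H = U" using minimal[of ?H] A_group_preimage[OF K] by blast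
  then show "K = {\<one>\<^bsub>Sec\<^esub>} \<or> K = carrier Sec"
    using A_group_preimage(3)[OF K] projL carrier_section by metis
qed

text \<open>
  Lagrange's theorem in the section, stated so that the quotient group no longer appears.
\<close>

lemma pow_section_order:
  assumes "x \<in> U"
  shows "x [^] order Sec \<in> L"
proof -
  have pow: "x [^]\<^bsub>G\<lparr>carrier := U\<rparr>\<^esub> n = x [^] n" for n :: nat
    using nat_pow_consistent by simp
  have "x [^] n \<in> U" for n :: nat
    using proj.G.nat_pow_closed[of x n] assms by (simp add: pow)
  moreover have "proj (x [^] order Sec) = proj x [^]\<^bsub>Sec\<^esub> order Sec"
    using proj.hom_nat_pow[of x "order Sec"] assms by (simp add: pow)
  moreover have "\<dots> = L"
    using proj.H.pow_order_eq_1 carrier_section assms proj_one by simp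
  ultimately show ?thesis using coset_join1[OF _ U_carrier L(1)] by metis
qed

end

section \<open>Subgroups of a cyclic group around a prime quotient\<close>

text \<open>
  Subgroups of a cyclic group become ideals of the integers, which turns inclusion into
  divisibility. The least positive exponent with power in \<open>H\<close> generates this ideal.
\<close>

lemma (in group) int_pow_exponents:
  assumes "c \<in> carrier G" "finite (carrier G)" "subgroup H G"
  shows "\<exists>u :: int. \<forall>j :: int. c [^] j \<in> H \<longleftrightarrow> u dvd j"
proof -
  define P where "P n \<longleftrightarrow> n > 0 \<and> c [^] int n \<in> H" for n :: nat
  have "P (order G)"
    using assms pow_order_eq_1 subgroup.one_closed order_gt_0_iff_finite
    unfolding P_def by (simp add: int_pow_int)
  define u where "u = (LEAST n. P n)"
  have u: "u > 0" "c [^] int u \<in> H"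
    using LeastI[of P, OF \<open>P (order G)\<close>] unfolding u_def P_def by auto
  have mult: "c [^] (int u * k) \<in> H" for k
    using subgroup_int_pow_closed[OF assms(3) u(2)] assms(1) int_pow_pow by simp
  have "int u dvd j" if j: "c [^] j \<in> H" for j
  proof (rule ccontr)
    assume nd: "\<not> int u dvd j"
    define r where "r = j mod int u"
    have r: "r > 0" "r < int u" using nd u(1) unfolding r_def by (simp_all add: dvd_eq_mod_eq_0 order.not_eq_order_implies_strict)
    have "c [^] r = c [^] (j + int u * (- (j div int u)))"
      unfolding r_def by (metis add_uminus_conv_diff minus_mult_div_eq_mod mult_minus_right)
    also have "\<dots> = c [^] j \<otimes> c [^] (int u * (- (j div int u)))"
      using assms(1) int_pow_mult by blast
    finally have "c [^] r \<in> H" using subgroup.m_closed[OF assms(3) j mult] by metis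
    then have "P (nat r)" unfolding P_def using r by simp
    then have "u \<le> nat r" unfolding u_def by (rule Least_le)
    then show False using r by simp
  qed
  moreover have "c [^] j \<in> H" if "int u dvd j" for j using that mult by (auto elim: dvdE)
  ultimately show ?thesis by metis
qed

lemma prime_multiple_dvdI:
  fixes u j p :: int
  assumes p: "Factorial_Ring.prime p" and "u \<noteq> 0"
    and u: "u dvd j" and j: "p ^ Suc (multiplicity p u) dvd j"
  shows "u * p dvd j"
proof -
  let ?a = "multiplicity p u"
  obtain m where m: "u = p ^ ?a * m" "\<not> p dvd m"
    by (rule multiplicity_decompose'[OF \<open>u \<noteq> 0\<close>]) (use p in auto)
  have "coprime (p ^ Suc ?a) m"
    using prime_imp_coprime[OF p m(2)] by simp
  moreover have "m dvd j" using u m(1) by (metis dvd_mult_right)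
  ultimately have "p ^ Suc ?a * m dvd j" using j by (intro divides_mult)
  moreover have "u * p = p ^ Suc ?a * m" using m(1) by (metis mult.assoc mult.commute power_Suc)
  ultimately show ?thesis by metis
qed

text \<open>
  A divisor of \<open>u * p\<close> splits into a power of \<open>p\<close> and a divisor of the \<open>p\<close>-free part of \<open>u\<close>.
  Unless it contains the full power of \<open>p\<close>, the first factor divides the \<open>p\<close>-part of \<open>u\<close>.
\<close>

lemma gcd_prime_multiple_dvd:
  fixes u k p :: int
  assumes p: "Factorial_Ring.prime p" and "u \<noteq> 0"
    and k: "\<not> p ^ Suc (multiplicity p u) dvd k"
  shows "gcd k (u * p) dvd u"
proof -
  let ?a = "multiplicity p u"
  obtain m where m: "u = p ^ ?a * m"
    using multiplicity_dvd[of p u] by (auto elim: dvdE)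
  have "u * p = p ^ Suc ?a * m" using m by (metis mult.assoc mult.commute power_Suc)
  then have "gcd k (u * p) dvd p ^ Suc ?a * m" by (metis gcd_dvd2)
  from division_decomp[OF this]
  obtain g1 g2 where g: "gcd k (u * p) = g1 * g2" "g1 dvd p ^ Suc ?a" "g2 dvd m" by blast
  obtain i where i: "i \<le> Suc ?a" "normalize g1 = p ^ i"
    using divides_primepow[OF p g(2)] by blast
  have "i \<noteq> Suc ?a"
  proof
    assume "i = Suc ?a"
    then have "p ^ Suc ?a dvd g1" using i by (metis dvd_normalize_iff dvd_refl)
    then have "p ^ Suc ?a dvd k" using g(1) by (metis dvd_mult2 dvd_trans gcd_dvd1)
    then show False using k by simp
  qed
  then have "g1 dvd p ^ ?a" using i by (metis le_SucE le_imp_power_dvd normalize_dvd_iff)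
  then have "g1 * g2 dvd p ^ ?a * m" using g(3) by (rule mult_dvd_mono)
  then show ?thesis using g(1) m by simp
qed

text \<open>
  Write \<open>L = \<langle>c\<^sup>u\<^sup>p\<rangle>\<close> and \<open>U = \<langle>c\<^sup>u\<rangle>\<close>. In the divisibility lattice a divisor of \<open>u * p\<close> fails to divide
  \<open>u\<close> exactly if it has the full \<open>p\<close>-part \<open>q\<close> of \<open>u * p\<close>. Hence the subgroups that contain \<open>L\<close> but not
  \<open>U\<close> are all contained in a single one of them, \<open>\<langle>c\<^sup>q\<rangle>\<close>; modulo \<open>L\<close> it is the Hall subgroup of
  order prime to \<open>p\<close>.
\<close>

lemma (in group) cyclic_prime_quotient_complement:
  assumes "finite (carrier G)" "cyclic_group G"
    and L: "subgroup L G" and U: "subgroup U G" and LU: "L \<subseteq> U" "L \<noteq> U"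
    and p: "Factorial_Ring.prime p" and pow: "\<And>x. x \<in> U \<Longrightarrow> x [^] (p::nat) \<in> L"
  obtains Q where "subgroup Q G" "L \<subseteq> Q" "Q \<inter> U \<subseteq> L"
    "\<And>H. subgroup H G \<Longrightarrow> L \<subseteq> H \<Longrightarrow> \<not> U \<subseteq> H \<Longrightarrow> H \<subseteq> Q"
proof -
  obtain c where c: "c \<in> carrier G" and gen: "carrier G = range (\<lambda>j::int. c [^] j)"
    using assms(2) unfolding cyclic_group by blast
  have elem: "\<exists>j::int. x = c [^] j" if "x \<in> carrier G" for x using that gen by blast
  obtain l :: int where "\<forall>j :: int. c [^] j \<in> L \<longleftrightarrow> l dvd j"
    using int_pow_exponents[OF c assms(1) L] by (rule exE)
  then have l: "c [^] j \<in> L \<longleftrightarrow> l dvd j" for j by (rule spec)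
  obtain u :: int where "\<forall>j :: int. c [^] j \<in> U \<longleftrightarrow> u dvd j"
    using int_pow_exponents[OF c assms(1) U] by (rule exE)
  then have u: "c [^] j \<in> U \<longleftrightarrow> u dvd j" for j by (rule spec)
  have "u dvd l" using l[of l] u[of l] LU by auto
  then obtain v where v: "l = u * v" by blast
  have "(c [^] u) [^] p \<in> L" using pow u[of u] by simp
  then have "l dvd u * int p" using l[of "u * int p"] c by (simp add: int_pow_pow[symmetric] int_pow_int)
  have "\<not> l dvd u"
  proof
    assume "l dvd u"
    then have "c [^] j \<in> L" if "c [^] j \<in> U" for j :: int
      using iffD2[OF l dvd_trans] iffD1[OF u that] by blast
    then have "U \<subseteq> L" using elem subgroup.mem_carrier[OF U] by (metis subsetI)
    then show False using LU by blast
  qed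
  then have "u \<noteq> 0" using \<open>u dvd l\<close> by auto
  have prime: "Factorial_Ring.prime (int p)" using p by simp
  have "v dvd int p" using \<open>l dvd u * int p\<close> v \<open>u \<noteq> 0\<close> by simp
  moreover have "\<not> is_unit v" using \<open>\<not> l dvd u\<close> v \<open>u \<noteq> 0\<close> by (metis dvd_refl mult_unit_dvd_iff)
  ultimately have "int p dvd v"
    using prime by (meson irreducibleD' prime_elem_imp_irreducible prime_imp_prime_elem)
  then have upl: "u * int p dvd l" using v by simp
  let ?q = "int p ^ Suc (multiplicity (int p) u)"
  define Q where "Q = {c [^] j | j. ?q dvd j}"
  show ?thesis
  proof (rule that[of Q])
    show "subgroup Q G"
    proof (rule subgroupI)
      show "Q \<subseteq> carrier G" unfolding Q_def using c by auto
      have "c [^] (0::int) \<in> Q" unfolding Q_def using dvd_0_right by blast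
      then show "Q \<noteq> {}" by blast
      show "inv a \<in> Q" if "a \<in> Q" for a
      proof -
        obtain j where "a = c [^] j" "?q dvd j" using \<open>a \<in> Q\<close> unfolding Q_def by blast
        then have "inv a = c [^] (- j)" "?q dvd - j" using c by (simp_all only: int_pow_neg dvd_minus_iff)
        then show ?thesis unfolding Q_def by blast
      qed
      show "a \<otimes> b \<in> Q" if "a \<in> Q" "b \<in> Q" for a b
      proof -
        obtain j k where "a = c [^] j" "?q dvd j" "b = c [^] k" "?q dvd k"
          using \<open>a \<in> Q\<close> \<open>b \<in> Q\<close> unfolding Q_def by blast
        then have "a \<otimes> b = c [^] (j + k)" "?q dvd j + k" using int_pow_mult[OF c] by (simp_all only: dvd_add)
        then show ?thesis unfolding Q_def by blast
      qed
    qed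
    have "?q dvd u * int p"
      using mult_dvd_mono[OF multiplicity_dvd[of "int p" u] dvd_refl[of "int p"]] by (simp add: mult.commute)
    then have ql: "?q dvd l" using upl dvd_trans by blast
    show "L \<subseteq> Q"
    proof
      fix x assume x: "x \<in> L"
      obtain j :: int where j: "x = c [^] j"
        using elem[OF subgroup.mem_carrier[OF L x]] by (rule exE)
      then have "l dvd j" using x l[of j] by simp
      then have "?q dvd j" by (rule dvd_trans[OF ql])
      then show "x \<in> Q" unfolding Q_def using j by blast
    qed
    show "Q \<inter> U \<subseteq> L"
    proof
      fix x assume x: "x \<in> Q \<inter> U"
      then obtain j :: int where j: "x = c [^] j" "?q dvd j" unfolding Q_def by blast
      then have "u dvd j" using u[of j] x by simp
      then have "u * int p dvd j" using j(2) by (rule prime_multiple_dvdI[OF prime \<open>u \<noteq> 0\<close>])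
      with \<open>l dvd u * int p\<close> have "l dvd j" by (rule dvd_trans)
      then show "x \<in> L" using l j by simp
    qed
    show "H \<subseteq> Q" if H: "subgroup H G" "L \<subseteq> H" "\<not> U \<subseteq> H" for H
    proof
      fix x assume x: "x \<in> H"
      obtain k :: int where k: "x = c [^] k"
        using elem[OF subgroup.mem_carrier[OF H(1) x]] by (rule exE)
      obtain h :: int where "\<forall>j :: int. c [^] j \<in> H \<longleftrightarrow> h dvd j"
    using int_pow_exponents[OF c assms(1) H(1)] by (rule exE)
  then have h: "c [^] j \<in> H \<longleftrightarrow> h dvd j" for j by (rule spec)
      have "?q dvd k"
      proof (rule ccontr)
        assume "\<not> ?q dvd k"
        then have "gcd k (u * int p) dvd u" by (rule gcd_prime_multiple_dvd[OF prime \<open>u \<noteq> 0\<close>])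
        moreover have "h dvd k" using h[of k] x k by simp
        moreover have "h dvd u * int p"
          using h[of l] l[of l] H(2) \<open>l dvd u * int p\<close> by (meson dvd_refl dvd_trans subsetD)
        ultimately have "h dvd u" by (meson dvd_trans gcd_greatest)
        then have "c [^] j \<in> H" if "c [^] j \<in> U" for j :: int
          using iffD2[OF h dvd_trans] iffD1[OF u that] by blast
        then have "U \<subseteq> H" using elem subgroup.mem_carrier[OF U] by (metis subsetI)
        then show False using H by blast
      qed
      then show "x \<in> Q" unfolding Q_def using k by blast
    qed
  qed
qed

section \<open>Intersections of coset S-rings\<close>

locale coset_S_ring_intersection = comm_group G for G (structure) +
  fixes \<F> :: "('a \<Rightarrow> int) set set"
  assumes finite_G: "finite (carrier G)" and F_nonempty: "\<F> \<noteq> {}"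
    and coset: "\<B> \<in> \<F> \<Longrightarrow> coset_S_ring G \<B>"
begin

lemma member: "\<B> \<in> \<F> \<Longrightarrow> abelian_S_ring G \<B>"
  using coset finite_G
  by (intro abelian_S_ring.intro abelian_S_ring_axioms.intro comm_group_axioms) (auto simp: coset_S_ring_def)

text \<open>
  The basic sets of the intersection are the classes on which all its elements agree. A function
  constant on these classes is constant on the basic sets of every \<open>\<B> \<in> \<F>\<close>, since the elements of
  the intersection belong to \<open>\<B>\<close>; so it lies in the intersection.
\<close>

lemma S_ring_Inter: "S_ring G (\<Inter>\<F>)"
proof -
  define cls where "cls x = {y \<in> carrier G. \<forall>f\<in>\<Inter>\<F>. f x = f y}" for x
  let ?P = "cls ` carrier G"
  have self: "x \<in> cls x" if "x \<in> carrier G" for x using that by (simp add: cls_def)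
  have eq: "cls x = cls y" if "z \<in> cls x" "z \<in> cls y" for x y z
  proof -
    have "f x = f y" if "f \<in> \<Inter>\<F>" for f
    proof -
      have "f x = f z" "f y = f z" using \<open>z \<in> cls x\<close> \<open>z \<in> cls y\<close> that unfolding cls_def by blast+
      then show ?thesis by simp
    qed
    then show ?thesis unfolding cls_def by (intro Collect_cong conj_cong ball_cong refl) metis
  qed
  have agree: "f x = f y" if "y \<in> cls x" "f \<in> \<Inter>\<F>" for f x y
    using that unfolding cls_def by blast
  have part: "partition_on (carrier G) ?P"
  proof (rule partition_onI)
    show "\<Union>?P = carrier G" using self by (auto simp: cls_def)
    show "{} \<notin> ?P" using self by auto
    show "disjnt p q" if "p \<in> ?P" "q \<in> ?P" "p \<noteq> q" for p q
    proof -
      obtain x y where "p = cls x" "q = cls y" using \<open>p \<in> ?P\<close> \<open>q \<in> ?P\<close> by blast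
      then show ?thesis using eq[of _ x y] \<open>p \<noteq> q\<close> unfolding disjnt_def by blast
    qed
  qed
  have span: "f \<in> int_span ?P \<longleftrightarrow> f \<in> \<Inter>\<F>" for f
  proof
    assume f: "f \<in> int_span ?P"
    show "f \<in> \<Inter>\<F>"
    proof
      fix \<B> assume B: "\<B> \<in> \<F>"
      interpret B: abelian_S_ring G \<B> by (rule member[OF B])
      have "f x = f y" if X: "X \<in> basic_sets G \<B>" "x \<in> X" "y \<in> X" for X x y
      proof -
        have xy: "x \<in> carrier G" "y \<in> carrier G" using X B.basic_subset by blast+
        have "g x = g y" if "g \<in> \<Inter>\<F>" for g
        proof -
          have "g \<in> \<B>" using that B by blast
          then show ?thesis by (rule B.const_on_basic[OF _ X])
        qed
        then have "x \<in> cls x" "y \<in> cls x" using xy by (simp_all add: cls_def)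
        moreover have "cls x \<in> ?P" using xy by blast
        ultimately show ?thesis using f[unfolded mem_int_span_iff[OF finite_G part]] by blast
      qed
      moreover have "f x = 0" if "x \<notin> carrier G" for x
        using f[unfolded mem_int_span_iff[OF finite_G part]] that by blast
      ultimately show "f \<in> \<B>" unfolding B.mem_iff by blast
    qed
  next
    assume f: "f \<in> \<Inter>\<F>"
    obtain \<B> where B: "\<B> \<in> \<F>" using F_nonempty by blast
    interpret B: abelian_S_ring G \<B> by (rule member[OF B])
    have fB: "f \<in> \<B>" using B f by blast
    have "f y = f z" if "y \<in> cls x" "z \<in> cls x" for x y z
    proof -
      have "f x = f y" "f x = f z" using that agree[OF _ f] by blast+
      then show ?thesis by simp
    qed
    moreover have "f x = 0" if "x \<notin> carrier G" for x using fB that by (rule B.zero_outside)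
    ultimately show "f \<in> int_span ?P" unfolding mem_int_span_iff[OF finite_G part] by blast
  qed
  have one: "{\<one>} \<in> ?P"
  proof -
    have mem: "simple_quantity {\<one>} \<in> \<Inter>\<F>"
    proof
      fix \<B> assume B: "\<B> \<in> \<F>"
      interpret B: abelian_S_ring G \<B> by (rule member[OF B])
      show "simple_quantity {\<one>} \<in> \<B>" using B.A_set_basic[OF B.one_basic] by (simp add: B.A_set_def)
    qed
    have "y = \<one>" if "y \<in> cls \<one>" for y
    proof -
      have "simple_quantity {\<one>} \<one> = simple_quantity {\<one>} y" by (rule agree[OF that mem])
      then show ?thesis by (simp add: simple_quantity_def split: if_splits)
    qed
    then have "cls \<one> = {\<one>}" using self by blast
    then show ?thesis using one_closed by (metis imageI)
  qed
  \<comment> \<open>composition with inversion, set to 0 outside the carrier to stay in the group ring\<close>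
  have inv_mem: "(\<lambda>x. if x \<in> carrier G then f (inv x) else 0) \<in> \<Inter>\<F>" if f: "f \<in> \<Inter>\<F>" for f
  proof
    fix \<B> assume B: "\<B> \<in> \<F>"
    interpret B: abelian_S_ring G \<B> by (rule member[OF B])
    have fB: "f \<in> \<B>" using f B by blast
    let ?g = "\<lambda>x. if x \<in> carrier G then f (inv x) else 0"
    have "?g x = ?g y" if X: "X \<in> basic_sets G \<B>" "x \<in> X" "y \<in> X" for X x y
    proof -
      have "inv x \<in> set_inv X" "inv y \<in> set_inv X" unfolding SET_INV_def using X by blast+
      then have "f (inv x) = f (inv y)" by (rule B.const_on_basic[OF fB B.inv_basic[OF X(1)]])
      moreover have "x \<in> carrier G" "y \<in> carrier G" using X B.basic_subset by blast+
      ultimately show ?thesis by simp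
    qed
    moreover have "?g x = 0" if "x \<notin> carrier G" for x using that by simp
    ultimately show "?g \<in> \<B>" unfolding B.mem_iff by blast
  qed
  have inv_cls: "inv y \<in> cls (inv x)" if "x \<in> carrier G" "y \<in> cls x" for x y
  proof -
    have y: "y \<in> carrier G" using that by (simp add: cls_def)
    have "f (inv x) = f (inv y)" if f: "f \<in> \<Inter>\<F>" for f
    proof -
      let ?g = "\<lambda>x. if x \<in> carrier G then f (inv x) else 0"
      have "?g x = ?g y" by (rule agree[OF \<open>y \<in> cls x\<close> inv_mem[OF f]])
      then show ?thesis using y \<open>x \<in> carrier G\<close> by simp
    qed
    then show ?thesis using y by (simp add: cls_def)
  qed
  have inv: "set_inv X \<in> ?P" if X: "X \<in> ?P" for X
  proof -
    obtain x where x: "x \<in> carrier G" "X = cls x" using X by blast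
    have "set_inv X = cls (inv x)"
    proof
      show "set_inv X \<subseteq> cls (inv x)" unfolding SET_INV_def x(2) using inv_cls[OF x(1)] by blast
      show "cls (inv x) \<subseteq> set_inv X"
      proof
        fix y assume y: "y \<in> cls (inv x)"
        then have "inv y \<in> cls x" using inv_cls[of "inv x" y] x(1) by simp
        moreover have "y = inv (inv y)" using y by (simp add: cls_def)
        ultimately show "y \<in> set_inv X" unfolding SET_INV_def x(2) by blast
      qed
    qed
    then show ?thesis using x by simp
  qed
  have mult: "f \<otimes>\<^bsub>group_ring G\<^esub> g \<in> int_span ?P" if "f \<in> int_span ?P" "g \<in> int_span ?P" for f g
    unfolding span
  proof
    fix \<B> assume B: "\<B> \<in> \<F>"
    interpret B: abelian_S_ring G \<B> by (rule member[OF B])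
    have "f \<in> \<B>" "g \<in> \<B>" using that B unfolding span by blast+
    then show "f \<otimes>\<^bsub>group_ring G\<^esub> g \<in> \<B>" by (rule B.mult_mem)
  qed
  have "int_span ?P = \<Inter>\<F>" using span by blast
  then show ?thesis using S_ringI(1)[OF is_group finite_G part one inv mult] by simp
qed

sublocale abelian_S_ring G "\<Inter>\<F>"
  by unfold_locales (rule finite_G, rule S_ring_Inter)

text \<open>
  Together with \<open>A_setD\<close> this replaces following chains of overlapping basic sets: a set closed
  under the basic sets of all members contains every basic set of the intersection that it meets.
\<close>

lemma A_set_InterI:
  assumes "Y \<subseteq> carrier G"
    and "\<And>\<B> Z z. \<B> \<in> \<F> \<Longrightarrow> Z \<in> basic_sets G \<B> \<Longrightarrow> z \<in> Z \<Longrightarrow> z \<in> Y \<Longrightarrow> Z \<subseteq> Y"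
  shows "A_set Y"
  unfolding A_set_def
proof (intro conjI assms(1) InterI)
  fix \<B> assume B: "\<B> \<in> \<F>"
  interpret B: abelian_S_ring G \<B> by (rule member[OF B])
  have "B.A_set Y" unfolding B.A_set_iff using assms B by blast
  then show "simple_quantity Y \<in> \<B>" by (simp add: B.A_set_def)
qed

lemma piece_coset:
  assumes X: "A_set X" and B: "\<B> \<in> \<F>" and Z: "Z \<in> basic_sets G \<B>" "z \<in> Z" "z \<in> X"
  obtains H where "subgroup H G" "Z = H #> z" "Z \<subseteq> X"
proof -
  interpret B: abelian_S_ring G \<B> by (rule member[OF B])
  have "B.A_set X" using X B by (auto simp: A_set_def B.A_set_def)
  then have sub: "Z \<subseteq> X" using B.A_setD Z by blast
  obtain H where H: "subgroup H G" "Z \<in> rcosets H"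
    using coset[OF B] Z(1) unfolding coset_S_ring_def by blast
  then obtain a where a: "a \<in> carrier G" "Z = H #> a" unfolding RCOSETS_def by blast
  then have "Z = H #> z" using repr_independence[OF _ a(1) H(1)] Z(2) by simp
  then show ?thesis using that H(1) sub by blast
qed

text \<open>
  The inductive step from \<open>U\<close> down to \<open>L\<close>. Either \<open>X <#> L\<close> contains a whole coset of \<open>U\<close> through some
  point of \<open>X\<close>. Since the points with this property form an A-set, every point of \<open>X\<close> has
  it, and then \<open>X <#> L = X <#> U\<close>. Or no such coset occurs. Then, for each coset \<open>H #> y\<close>
  inside \<open>X\<close> that is a basic set of a member of \<open>\<F>\<close>, the group \<open>H <#> L\<close> does
  not contain \<open>U\<close>, so \<open>H\<close> is contained in \<open>Q\<close>. Hence \<open>X\<close> never leaves one coset of \<open>Q\<close>, and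
  from \<open>Q \<inter> U \<subseteq> L\<close> it follows that \<open>X <#> L\<close> is the part of the coset \<open>X <#> U\<close> inside \<open>Q #> x\<close>.
\<close>

lemma coset_step:
  assumes L: "subgroup L G" "A_set L" and U: "subgroup U G" "A_set U" and LU: "L \<subseteq> U"
    and Q: "subgroup Q G" "L \<subseteq> Q" "Q \<inter> U \<subseteq> L"
      "\<And>H. subgroup H G \<Longrightarrow> L \<subseteq> H \<Longrightarrow> \<not> U \<subseteq> H \<Longrightarrow> H \<subseteq> Q"
    and X: "X \<in> basic" "x \<in> X" and K: "subgroup K G" "X <#> U = K #> x"
  shows "\<exists>K'. subgroup K' G \<and> X <#> L = K' #> x"
proof -
  note XG = basic_subset[OF X(1)]
  note UG = subgroup.mem_carrier[OF U(1)] and LG = subgroup.mem_carrier[OF L(1)] and QG = subgroup.mem_carrier[OF Q(1)]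
  have xG: "x \<in> carrier G" using X XG by blast
  have XL: "X <#> L \<subseteq> X <#> U" by (rule mono_set_mult[OF order.refl LU])
  \<comment> \<open>as \<open>U\<close> is closed under inverses, an element \<open>y\<close> of \<open>G\<close> is outside \<open>?T\<close> iff the whole coset
    of \<open>U\<close> through \<open>y\<close> lies in \<open>X <#> L\<close>\<close>
  let ?T = "(carrier G - (X <#> L)) <#> U"
  have T: "A_set (carrier G - ?T)"
    by (intro A_set_compl A_set_mult A_set_basic X L U)
  show ?thesis
  proof (cases "X \<subseteq> ?T")
    case False
    then obtain y where y: "y \<in> X" "y \<in> carrier G - ?T" using XG by blast
    have XT: "X \<subseteq> carrier G - ?T" by (rule A_setD[OF T X(1) y])
    have "X <#> U \<subseteq> X <#> L"
    proof
      fix z assume "z \<in> X <#> U"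
      then obtain a u where a: "a \<in> X" "u \<in> U" "z = a \<otimes> u" unfolding set_mult_def by blast
      have aG: "a \<in> carrier G" "u \<in> carrier G" using a XG UG by blast+
      show "z \<in> X <#> L"
      proof (rule ccontr)
        assume "z \<notin> X <#> L"
        moreover have "z \<in> carrier G" using a aG by simp
        moreover have "a = z \<otimes> inv u" using a aG by (simp add: m_assoc)
        ultimately have "a \<in> ?T" unfolding set_mult_def using subgroup.m_inv_closed[OF U(1) a(2)] by blast
        then show False using XT a by blast
      qed
    qed
    then have "X <#> L = K #> x" using XL K(2) by blast
    then show ?thesis using K(1) by blast
  next
    case True
    have piece: "Z \<subseteq> Q #> y" if B: "\<B> \<in> \<F>" and Z: "Z \<in> basic_sets G \<B>" "y \<in> Z" and y: "y \<in> X"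
      for \<B> Z y
    proof -
      obtain H where H: "subgroup H G" "Z = H #> y" "Z \<subseteq> X"
        by (rule piece_coset[OF A_set_basic[OF X(1)] B Z y])
      obtain w u where w: "w \<in> carrier G" "w \<notin> X <#> L" "u \<in> U" "y = w \<otimes> u"
        using True y unfolding set_mult_def[of G _ U] by blast
      have HG: "h \<in> carrier G" if "h \<in> H" for h using subgroup.mem_carrier[OF H(1) that] .
      have sub: "subgroup (H <#> L) G" by (rule mult_subgroups[OF H(1) L(1)])
      have "l \<in> H <#> L" if "l \<in> L" for l
        unfolding set_mult_def using subgroup.one_closed[OF H(1)] that LG[OF that] l_one[of l] by force
      then have LHL: "L \<subseteq> H <#> L" by blast
      have HHL: "h \<in> H <#> L" if "h \<in> H" for h
        unfolding set_mult_def using subgroup.one_closed[OF L(1)] that HG[OF that] r_one[of h] by force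
      \<comment> \<open>the witness \<open>w = y \<otimes> inv u\<close> outside \<open>X <#> L\<close> shows that \<open>U\<close> is not contained in \<open>H <#> L\<close>\<close>
      have "inv u \<notin> H <#> L"
      proof
        assume "inv u \<in> H <#> L"
        then obtain h l where hl: "h \<in> H" "l \<in> L" "inv u = h \<otimes> l" unfolding set_mult_def by blast
        have car: "h \<in> carrier G" "l \<in> carrier G" "u \<in> carrier G" "y \<in> carrier G"
          using hl w y HG LG UG XG by blast+
        have "w = y \<otimes> inv u" using w car by (simp add: m_assoc)
        also have "\<dots> = (h \<otimes> y) \<otimes> l" unfolding hl(3) using car by (simp add: m_ac)
        finally have "w = (h \<otimes> y) \<otimes> l" .
        moreover have "h \<otimes> y \<in> X" using H hl unfolding r_coset_def by blast
        ultimately have "w \<in> X <#> L" unfolding set_mult_def using hl by blast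
        then show False using w by blast
      qed
      then have "\<not> U \<subseteq> H <#> L" using subgroup.m_inv_closed[OF U(1) w(3)] by blast
      then have "H <#> L \<subseteq> Q" by (rule Q(4)[OF sub LHL])
      then have "H \<subseteq> Q" using HHL by blast
      then show ?thesis unfolding H(2) r_coset_def by blast
    qed
    have "A_set (X \<inter> (Q #> x))"
    proof (rule A_set_InterI)
      show "X \<inter> (Q #> x) \<subseteq> carrier G" using XG by blast
      fix \<B> Z z assume B: "\<B> \<in> \<F>" and Z: "Z \<in> basic_sets G \<B>" "z \<in> Z" and z: "z \<in> X \<inter> (Q #> x)"
      have "Z \<subseteq> Q #> z" using piece[OF B Z] z by blast
      moreover have "Q #> x = Q #> z" using repr_independence[OF _ xG Q(1)] z by blast
      moreover have "Z \<subseteq> X" using piece_coset[OF A_set_basic[OF X(1)] B Z] z by blast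
      ultimately show "Z \<subseteq> X \<inter> (Q #> x)" by blast
    qed
    then have XQ: "X \<subseteq> Q #> x" using A_setD[OF _ X(1) X(2)] X(2) rcos_self[OF xG Q(1)] by blast
    have "X <#> L = (K \<inter> Q) #> x"
    proof
      show "X <#> L \<subseteq> (K \<inter> Q) #> x"
      proof
        fix z assume z: "z \<in> X <#> L"
        then obtain a l where a: "a \<in> X" "l \<in> L" "z = a \<otimes> l" unfolding set_mult_def by blast
        obtain q where q: "q \<in> Q" "a = q \<otimes> x" using a XQ unfolding r_coset_def by blast
        obtain k where k: "k \<in> K" "z = k \<otimes> x" using z XL K unfolding r_coset_def by blast
        have car: "q \<in> carrier G" "l \<in> carrier G" "k \<in> carrier G"
          using q a k QG LG subgroup.mem_carrier[OF K(1)] by blast+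
        have "z = (q \<otimes> l) \<otimes> x" using a(3) q car xG by (simp add: m_ac)
        then have "k = q \<otimes> l" using k car xG by simp
        then have "k \<in> Q" using q a Q(2) subgroup.m_closed[OF Q(1)] by blast
        then show "z \<in> (K \<inter> Q) #> x" unfolding r_coset_def using k by blast
      qed
      show "(K \<inter> Q) #> x \<subseteq> X <#> L"
      proof
        fix z assume "z \<in> (K \<inter> Q) #> x"
        then obtain k where k: "k \<in> K" "k \<in> Q" "z = k \<otimes> x" unfolding r_coset_def by blast
        then have "z \<in> X <#> U" unfolding K(2) r_coset_def by blast
        then obtain a u where a: "a \<in> X" "u \<in> U" "z = a \<otimes> u" unfolding set_mult_def by blast
        obtain q where q: "q \<in> Q" "a = q \<otimes> x" using a XQ unfolding r_coset_def by blast
        have car: "q \<in> carrier G" "u \<in> carrier G" "k \<in> carrier G"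
          using q a k QG UG by blast+
        have "k \<otimes> x = (q \<otimes> u) \<otimes> x" using a(3) k(3) q car xG by (simp add: m_ac)
        then have "k = q \<otimes> u" using car xG by simp
        then have "u = inv q \<otimes> k" using car by (simp add: m_assoc[symmetric])
        then have "u \<in> Q" using q k subgroup.m_closed[OF Q(1)] subgroup.m_inv_closed[OF Q(1)] by blast
        then have "u \<in> L" using Q(3) a by blast
        then show "z \<in> X <#> L" unfolding set_mult_def using a by blast
      qed
    qed
    then show ?thesis using subgroups_Inter_pair[OF K(1) Q(1)] by blast
  qed
qed

text \<open>
  Downward induction over the \<open>\<B>\<close>-groups \<open>L\<close>, starting at \<open>G\<close>. For a minimal such group \<open>U\<close>
  strictly above \<open>L\<close> the section \<open>U/L\<close> is primitive, hence of prime order, and the step above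
  applies. The groups of \<open>\<B>\<close> are A-groups for the intersection because \<open>\<B>\<close> is contained in it.
\<close>

lemma coset_modulo_A_group:
  assumes cyc: "cyclic_group G" and quasi: "quasidense G \<B>" and sub: "\<B> \<subseteq> \<Inter>\<F>"
    and X: "X \<in> basic" "x \<in> X" and L: "A_group G \<B> L"
  shows "\<exists>K. subgroup K G \<and> X <#> L = K #> x"
  using L
proof (induction "card (carrier G) - card L" arbitrary: L rule: less_induct)
  case less
  interpret B: abelian_S_ring G \<B>
    using quasi finite_G by unfold_locales (auto simp: quasidense_def)
  have A_set: "A_set H" if "B.A_set H" for H
    using that sub by (auto simp: A_set_def B.A_set_def)
  have L: "subgroup L G" "B.A_set L" using less.prems by (simp_all add: B.A_group_iff)
  have xG: "x \<in> carrier G" using X basic_subset by blast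
  show ?case
  proof (cases "L = carrier G")
    case True
    have "X <#> carrier G = carrier G #> x"
    proof
      show "carrier G #> x \<subseteq> X <#> carrier G"
        unfolding r_coset_def set_mult_def using X(2) xG m_comm by fastforce
      show "X <#> carrier G \<subseteq> carrier G #> x"
        using setmult_subset_G[OF basic_subset[OF X(1)] order.refl] coset_join2[OF xG subgroup_self xG] by simp
    qed
    then show ?thesis using True subgroup_self by blast
  next
    case False
    let ?above = "\<lambda>H. A_group G \<B> H \<and> L \<subseteq> H \<and> L \<noteq> H"
    have "B.A_set (carrier G)" unfolding B.A_set_iff using B.basic_subset by blast
    then have "?above (carrier G)"
      using False subgroup.subset[OF L(1)] subgroup_self by (simp add: B.A_group_iff)
    then obtain U where U: "?above U" and least: "\<And>H. ?above H \<Longrightarrow> card U \<le> card H"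
      using ex_has_least_nat[of ?above "carrier G" card] by blast
    interpret sec: abelian_S_ring_section G \<B> U L
      using U less.prems by unfold_locales auto
    have finU: "finite U" using finite_subset[OF subgroup.subset[OF sec.U(1)] finite_G] .
    have "H = L \<or> H = U" if "A_group G \<B> H" "L \<subseteq> H" "H \<subseteq> U" for H
      using least[of H] card_seteq[OF finU \<open>H \<subseteq> U\<close>] that by blast
    then have "primitive_S_ring sec.Sec (section_S_ring G \<B> U L)"
      using sec.primitive_section U by blast
    then have prime: "Factorial_Ring.prime (order sec.Sec)"
      using quasi sec.A_section unfolding quasidense_def by blast
    obtain Q where Q: "subgroup Q G" "L \<subseteq> Q" "Q \<inter> U \<subseteq> L"
      "\<And>H. subgroup H G \<Longrightarrow> L \<subseteq> H \<Longrightarrow> \<not> U \<subseteq> H \<Longrightarrow> H \<subseteq> Q"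
      using cyclic_prime_quotient_complement[OF finite_G cyc L(1) sec.U(1) _ _ prime sec.pow_section_order] U
      by blast
    have "card L < card U" using psubset_card_mono[OF finU] U by blast
    moreover have "card U \<le> card (carrier G)"
      using card_mono[OF finite_G subgroup.subset[OF sec.U(1)]] .
    ultimately have "card (carrier G) - card U < card (carrier G) - card L" by simp
    then obtain K where "subgroup K G" "X <#> U = K #> x"
      using less.hyps[of U] U by blast
    then show ?thesis
      using coset_step[OF L(1) A_set[OF L(2)] sec.U(1) A_set[OF sec.U(2)] _ Q X] U by blast
  qed
qed

lemma coset_S_ring_Inter:
  assumes cyc: "cyclic_group G" and quasi: "quasidense G \<B>" and sub: "\<B> \<subseteq> \<Inter>\<F>"
  shows "coset_S_ring G (\<Inter>\<F>)"
  unfolding coset_S_ring_def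
proof (intro conjI ballI S_ring_Inter)
  interpret B: abelian_S_ring G \<B>
    using quasi finite_G by unfold_locales (auto simp: quasidense_def)
  have one: "A_group G \<B> {\<one>}"
    using triv_subgroup B.A_set_basic[OF B.one_basic] by (simp add: B.A_group_iff)
  fix X assume X: "X \<in> basic"
  then obtain x where x: "x \<in> X" using basic_nonempty by blast
  obtain K where K: "subgroup K G" "X <#> {\<one>} = K #> x"
    using coset_modulo_A_group[OF cyc quasi sub X x one] by blast
  have "a \<otimes> \<one> = a" if "a \<in> X" for a using that basic_subset[OF X] by auto
  then have "X <#> {\<one>} = X" unfolding set_mult_def by auto
  then have "X \<in> rcosets K" unfolding RCOSETS_def using K(2) x basic_subset[OF X] by auto
  then show "\<exists>H. subgroup H G \<and> X \<in> rcosets H" using K(1) by blast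
qed

end

theorem theorem8p5:
  fixes G :: "('a, 'b) monoid_scheme"
    and \<F> :: "('a \<Rightarrow> int) set set"
    and \<A> :: "('a \<Rightarrow> int) set"
  assumes "group G" and "finite (carrier G)" and "cyclic_group G"
    and "\<F> \<noteq> {}"
    and "\<And>\<B>. \<B> \<in> \<F> \<Longrightarrow> coset_S_ring G \<B>"
    and "\<A> = \<Inter>\<F>"
    and "\<exists>\<B>. quasidense G \<B> \<and> \<B> \<subseteq> \<A>"
  shows "coset_S_ring G \<A>"
proof -
  interpret comm_group G using group.cyclic_imp_abelian_group assms(1,3) by blast
  interpret coset_S_ring_intersection G \<F>
    using assms by unfold_locales
  show ?thesis using coset_S_ring_Inter assms(3,6,7) by blast
qed

end
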